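(* Let $t \ge 1$ be an integer and let $1 \le i \le t$. For any integer $s$ with $2^{t+1} - 2^{(t+1)-i} < s < 2^{t+1} - 2^{(t+1)-(i+1)}$, there does not exist any $t$-$(v,t+1)$ Latin trade of volume $s$ (for any positive integer $v$).
   Context: Let $t \le k$ and $v$ be positive integers, $V = \{1,\dots,v\}$, and let $V^k$ be the set of ordered $k$-tuples of elements of $V$. For a $t$-subset $I = \{i_1 < \cdots < i_t\}$ of $\{1,\dots,k\}$ and $(u_1,\dots,u_t) \in V^t$, the tuple $(x_1,\dots,x_k) \in V^k$ is said to contain $(u_1,\dots,u_t)_I$ if $x_{i_j} = u_j$ for all $j = 1,\dots,t$. A $t$-$(v,k)$ Latin trade of volume $s$ is a pair $T = (T_1,T_2)$ of disjoint collections (finite multisets, i.e. repeated elements are allowed; disjoint means no tuple occurs in both), each consisting of $s$ elements of $V^k$ counted with multiplicity, such that for each $t$-subset $I \subseteq \{1,\dots,k\}$ and each $(u_1,\dots,u_t) \in V^t$, the number of elements (with multiplicity) of $T_1$ containing $(u_1,\dots,u_t)_I$ equals the number of elements of $T_2$ containing $(u_1,\dots,u_t)_I$. *)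

theory Defs
  imports Main "HOL-Library.Multiset"
begin

text \<open>Tuples are lists, so coordinates are numbered \<open>0, \<dots>, k - 1\<close> instead of \<open>1, \<dots>, k\<close>;
  the entries range over \<open>V = {1, \<dots>, v}\<close>.\<close>

definition tuples :: "nat \<Rightarrow> nat \<Rightarrow> nat list set" where
  "tuples v k = {x. length x = k \<and> set x \<subseteq> {1..v}}"

text \<open>\<open>sorted_list_of_set I ! j\<close> is the \<open>j\<close>-th smallest element of \<open>I\<close>, counted from 0.
  Only used for \<open>I \<subseteq> {..<length x}\<close> and \<open>length u = card I\<close>.\<close>

definition tuple_contains :: "nat list \<Rightarrow> nat set \<Rightarrow> nat list \<Rightarrow> bool" where
  "tuple_contains x I u \<longleftrightarrow> (\<forall>j < length u. x ! (sorted_list_of_set I ! j) = u ! j)"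

definition latin_trade ::
    "nat \<Rightarrow> nat \<Rightarrow> nat \<Rightarrow> nat \<Rightarrow> nat list multiset \<times> nat list multiset \<Rightarrow> bool" where
  "latin_trade t v k s T \<longleftrightarrow> (case T of (T1, T2) \<Rightarrow>
     set_mset T1 \<subseteq> tuples v k \<and> set_mset T2 \<subseteq> tuples v k \<and>
     set_mset T1 \<inter> set_mset T2 = {} \<and>
     size T1 = s \<and> size T2 = s \<and>
     (\<forall>I u. I \<subseteq> {..<k} \<and> card I = t \<and> u \<in> tuples v t \<longrightarrow>
        size {# x \<in># T1. tuple_contains x I u #} = size {# x \<in># T2. tuple_contains x I u #}))"

end

theory Submission
  imports Defs
begin

text \<open>
  Regard a trade as the integer function \<open>f = count T1 - count T2\<close> on \<open>V\<^sup>t\<^sup>+\<^sup>1\<close>: all its line sums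
  vanish and its \<open>\<ell>\<^sub>1\<close>-norm is \<open>2 s\<close>. By induction on the dimension \<open>n\<close>, a norm below \<open>2\<^sup>n\<^sup>+\<^sup>1\<close> has
  the form \<open>2\<^sup>n\<^sup>+\<^sup>1 - 2\<^sup>j\<^sup>+\<^sup>1\<close> with \<open>j \<le> n\<close>. Indeed, the slices of \<open>f\<close> along the first coordinate have
  vanishing line sums and add up to \<open>0\<close>, and by induction a nonzero slice has norm at least
  \<open>2\<^sup>n\<^sup>-\<^sup>1\<close>. So at most three slices are nonzero. A single one is impossible, two are opposite to each
  other and double the norm, and for three slices of norms \<open>2\<^sup>n - 2\<^sup>j\<close> the upper bound forces two of
  them to have the minimum norm \<open>2\<^sup>n\<^sup>-\<^sup>1\<close>.
\<close>

section \<open>Integer functions with vanishing line sums\<close>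

text \<open>The split into \<open>ys\<close> and \<open>zs\<close> encodes both the direction of a
  line, coordinate \<open>length ys\<close>, and its fixed entries. The dimension is meant to be
  positive: at \<open>n = 0\<close> the truncated \<open>n - 1\<close> would constrain
  1-tuples.\<close>

definition line_balanced :: "nat \<Rightarrow> nat \<Rightarrow> (nat list \<Rightarrow> int) \<Rightarrow> bool" where
  "line_balanced v n f \<longleftrightarrow>
     (\<forall>ys zs. ys @ zs \<in> tuples v (n - 1) \<longrightarrow> (\<Sum>a\<in>{1..v}. f (ys @ a # zs)) = 0)"

definition l1_norm :: "nat \<Rightarrow> nat \<Rightarrow> (nat list \<Rightarrow> int) \<Rightarrow> int" where
  "l1_norm v n f = (\<Sum>x\<in>tuples v n. \<bar>f x\<bar>)"

lemma finite_tuples [simp]: "finite (tuples v n)"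
  using finite_lists_length_eq[of "{1..v}" n] by (simp add: tuples_def conj_commute)

lemma tuples_0 [simp]: "tuples v 0 = {[]}"
  by (auto simp: tuples_def)

lemma tuples_Suc: "tuples v (Suc n) = (\<lambda>(a, x). a # x) ` ({1..v} \<times> tuples v n)"
  by (auto simp: tuples_def length_Suc_conv image_iff)

lemma l1_norm_nonneg: "0 \<le> l1_norm v n f"
  by (simp add: l1_norm_def sum_nonneg)

lemma l1_norm_Suc: "l1_norm v (Suc n) f = (\<Sum>a\<in>{1..v}. l1_norm v n (\<lambda>x. f (a # x)))"
proof -
  have "inj_on (\<lambda>(a, x). a # x) ({1..v} \<times> tuples v n)"
    by (auto simp: inj_on_def)
  then show ?thesis
    by (simp add: l1_norm_def tuples_Suc sum.reindex sum.cartesian_product case_prod_unfold)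
qed

text \<open>A line of the slice becomes a line of \<open>f\<close> once \<open>a\<close> is put in
  front of its fixed prefix. The slice needs positive dimension, since otherwise it contains no
  lines.\<close>

lemma line_balanced_slice:
  assumes "line_balanced v (Suc (Suc n)) f" "a \<in> {1..v}"
  shows "line_balanced v (Suc n) (\<lambda>x. f (a # x))"
  unfolding line_balanced_def
proof (intro allI impI)
  fix ys zs assume "ys @ zs \<in> tuples v (Suc n - 1)"
  with assms(2) have "(a # ys) @ zs \<in> tuples v (Suc (Suc n) - 1)"
    by (auto simp: tuples_def)
  with assms(1) show "(\<Sum>b\<in>{1..v}. f (a # ys @ b # zs)) = 0"
    unfolding line_balanced_def by fastforce
qed

text \<open>Lines in the first direction make each slice minus the sum of the others; the triangle
  inequality is then applied pointwise.\<close>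

lemma l1_norm_slice_le:
  assumes "line_balanced v (Suc n) f" "a \<in> {1..v}"
  shows "l1_norm v n (\<lambda>x. f (a # x)) \<le> (\<Sum>b\<in>{1..v} - {a}. l1_norm v n (\<lambda>x. f (b # x)))"
proof -
  have "\<bar>f (a # x)\<bar> \<le> (\<Sum>b\<in>{1..v} - {a}. \<bar>f (b # x)\<bar>)" if "x \<in> tuples v n" for x
  proof -
    have "(\<Sum>b\<in>{1..v}. f ([] @ b # x)) = 0"
      using assms(1) that unfolding line_balanced_def by (metis append_Nil diff_Suc_1)
    then have "f (a # x) = - (\<Sum>b\<in>{1..v} - {a}. f (b # x))"
      using assms(2) by (simp add: sum.remove)
    then show ?thesis by (simp add: sum_abs)
  qed
  then have "l1_norm v n (\<lambda>x. f (a # x)) \<le> (\<Sum>x\<in>tuples v n. \<Sum>b\<in>{1..v} - {a}. \<bar>f (b # x)\<bar>)"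
    unfolding l1_norm_def by (rule sum_mono)
  then show ?thesis
    unfolding l1_norm_def by (subst sum.swap)
qed

section \<open>The norms that can occur below the bound\<close>

lemma exp_add_gt_exp_two_max:
  fixes p q r m :: nat
  assumes "p \<le> m" "q \<le> m" "r \<le> m" "(2::int) ^ (m + 1) < 2 ^ p + 2 ^ q + 2 ^ r"
  shows "p = m \<and> q = m \<or> p = m \<and> r = m \<or> q = m \<and> r = m"
proof (rule ccontr)
  assume neg: "\<not> ?thesis"
  then obtain k where m: "m = Suc k" using assms by (cases m) auto
  have half: "(2::int) ^ x \<le> 2 ^ k" if "x \<le> m" "x \<noteq> m" for x
    using that m by (intro power_increasing) auto
  have full: "(2::int) ^ x \<le> 2 * 2 ^ k" if "x \<le> m" for x
    using power_increasing[OF that, of "2::int"] m by simp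
  \<comment> \<open>With at most one exponent equal to \<open>m\<close>, one term is at most
    \<open>2 * 2 ^ k\<close> and the other two at most \<open>2 ^ k\<close> each.\<close>
  from neg assms(1-3) half full have "(2::int) ^ p + 2 ^ q + 2 ^ r \<le> 4 * 2 ^ k"
    by (smt (verit, best))
  with assms(4) m show False by simp
qed

text \<open>This isolates the arithmetic of the induction step: \<open>w a\<close> plays the norm of
  the slice at \<open>a\<close>, and the proof splits on the number of nonzero weights.\<close>

lemma slice_sum_spectrum:
  fixes w :: "'a \<Rightarrow> int"
  assumes fin: "finite A" and nonneg: "\<And>a. a \<in> A \<Longrightarrow> 0 \<le> w a"
    and spec: "\<And>a. a \<in> A \<Longrightarrow> w a < 2 ^ (m + 2) \<Longrightarrow> \<exists>j\<le>m + 1. w a + 2 ^ (j + 1) = 2 ^ (m + 2)"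
    and tri: "\<And>a. a \<in> A \<Longrightarrow> w a \<le> sum w (A - {a})"
    and less: "sum w A < 2 ^ (m + 3)"
  shows "\<exists>j\<le>m + 2. sum w A + 2 ^ (j + 1) = 2 ^ (m + 3)"
proof -
  define S where "S = {a\<in>A. w a \<noteq> 0}"
  have finS: "finite S" and SA: "S \<subseteq> A" using fin by (auto simp: S_def)
  have sumS: "sum w A = sum w S"
    using fin by (intro sum.mono_neutral_right) (auto simp: S_def)
  have triS: "w a \<le> sum w (S - {a})" if "a \<in> S" for a
  proof -
    have "sum w (A - {a}) = sum w (S - {a})"
      using fin by (intro sum.mono_neutral_right) (auto simp: S_def)
    with tri[of a] that show ?thesis by (auto simp: S_def)
  qed
  have specS: "\<exists>j\<le>m. w a + 2 ^ (j + 1) = 2 ^ (m + 2)" if a: "a \<in> S" "w a < 2 ^ (m + 2)" for a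
  proof -
    from a spec[of a] SA obtain j where j: "j \<le> m + 1" "w a + 2 ^ (j + 1) = 2 ^ (m + 2)" by blast
    \<comment> \<open>The exponent \<open>m + 1\<close> would give weight 0, which \<open>S\<close>
      excludes.\<close>
    moreover have "j \<noteq> m + 1" using j a by (auto simp: S_def)
    ultimately have "j \<le> m" by simp
    with j show ?thesis by blast
  qed
  have low: "2 ^ (m + 1) \<le> w a" if a: "a \<in> S" for a
  proof (cases "w a < 2 ^ (m + 2)")
    case True
    then obtain j where j: "j \<le> m" "w a + 2 ^ (j + 1) = 2 ^ (m + 2)" using specS a by blast
    have "(2::int) ^ j \<le> 2 ^ m" using j by (intro power_increasing) auto
    moreover have "w a + 2 * 2 ^ j = 4 * 2 ^ m" using j by simp
    ultimately have "2 * 2 ^ m \<le> w a" by linarith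
    then show ?thesis by simp
  next
    case False
    have "(2::int) ^ (m + 1) \<le> 2 ^ (m + 2)" by (intro power_increasing) auto
    with False show ?thesis by linarith
  qed
  have "int (card S) * 2 ^ (m + 1) \<le> sum w S"
    using sum_mono[of S "\<lambda>_. 2 ^ (m + 1)" w] low by simp
  also have "\<dots> < 4 * 2 ^ (m + 1)" using less sumS by (simp add: power_add)
  finally have "int (card S) < 4" by simp
  then consider "card S = 0" | "card S = 1" | "card S = 2" | "card S = 3" by linarith
  then show ?thesis
  proof cases
    case 1
    with finS sumS show ?thesis by (intro exI[of _ "m + 2"]) (simp add: power_add)
  next
    case 2
    then obtain a where S: "S = {a}" by (auto simp: card_1_singleton_iff)
    then have "w a \<le> 0" "a \<in> S" using triS[of a] by auto
    with nonneg[of a] show ?thesis by (auto simp: S_def)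
  next
    case 3
    then obtain a b where S: "S = {a, b}" "a \<noteq> b" by (auto simp: card_2_iff)
    \<comment> \<open>Each weight is bounded by the only other one, so they agree; doubling then
      shifts \<open>j\<close> to \<open>j + 1\<close>.\<close>
    have "w a \<le> w b" "w b \<le> w a"
      using triS[of a] triS[of b] S by (simp_all add: insert_Diff_if)
    then have sum: "sum w A = 2 * w a" using sumS S by simp
    with less have "w a < 2 ^ (m + 2)" by (simp add: power_add)
    with specS[of a] S obtain j where "j \<le> m" "w a + 2 ^ (j + 1) = 2 ^ (m + 2)" by blast
    with sum show ?thesis by (intro exI[of _ "j + 1"]) (simp add: power_add)
  next
    case 4
    then obtain a b c where S: "S = {a, b, c}" "a \<noteq> b" "a \<noteq> c" "b \<noteq> c"
      by (auto simp: card_3_iff)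
    have sum: "sum w A = w a + w b + w c" using sumS S by simp
    have lows: "2 ^ (m + 1) \<le> w a" "2 ^ (m + 1) \<le> w b" "2 ^ (m + 1) \<le> w c"
      using low S by auto
    \<comment> \<open>The total is below \<open>4 * 2 ^ (m + 1)\<close>, and the other two weights
      already use up at least half of this.\<close>
    with less sum have "w a < 2 ^ (m + 2)" "w b < 2 ^ (m + 2)" "w c < 2 ^ (m + 2)"
      by (simp_all add: power_add)
    with specS S obtain p q r where
      pqr: "p \<le> m" "w a + 2 ^ (p + 1) = 2 ^ (m + 2)"
           "q \<le> m" "w b + 2 ^ (q + 1) = 2 ^ (m + 2)"
           "r \<le> m" "w c + 2 ^ (r + 1) = 2 ^ (m + 2)" by (metis insertCI)
    with less sum have "(2::int) ^ (m + 1) < 2 ^ p + 2 ^ q + 2 ^ r" by (simp add: power_add)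
    with pqr have "p = m \<and> q = m \<or> p = m \<and> r = m \<or> q = m \<and> r = m"
      by (intro exp_add_gt_exp_two_max)
    \<comment> \<open>Here \<open>j\<close> is the exponent left over after removing two that equal
      \<open>m\<close>.\<close>
    then obtain j where "j \<le> m" "(2::int) ^ p + 2 ^ q + 2 ^ r = 2 ^ (m + 1) + 2 ^ j"
      using pqr by (elim disjE) (auto simp: power_add)
    with pqr sum show ?thesis by (intro exI[of _ j]) (simp add: power_add)
  qed
qed

lemma line_balanced_norm_spectrum:
  assumes "line_balanced v (m + 1) f" "l1_norm v (m + 1) f < 2 ^ (m + 2)"
  shows "\<exists>j\<le>m + 1. l1_norm v (m + 1) f + 2 ^ (j + 1) = 2 ^ (m + 2)"
  using assms
proof (induction m arbitrary: f)
  case 0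
  have norm: "l1_norm v 1 f = (\<Sum>a\<in>{1..v}. \<bar>f [a]\<bar>)"
    using l1_norm_Suc[of v 0 f] by (simp add: l1_norm_def)
  have "(\<Sum>a\<in>{1..v}. f ([] @ a # [])) = 0"
    using 0(1) unfolding line_balanced_def by fastforce
  \<comment> \<open>Since \<open>\<bar>z\<bar> + z\<close> is always even, the norm has the parity
    of the line sum 0.\<close>
  moreover have "even (\<Sum>a\<in>{1..v}. \<bar>f [a]\<bar> + f [a])" by (rule dvd_sum) auto
  ultimately have "even (l1_norm v 1 f)" unfolding norm by (simp add: sum.distrib)
  moreover have "0 \<le> l1_norm v 1 f" "l1_norm v 1 f < 4" using 0(2) l1_norm_nonneg by auto
  ultimately have "l1_norm v 1 f = 0 \<or> l1_norm v 1 f = 2" by presburger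
  then show ?case
    by (elim disjE) (auto intro: exI[of _ "0::nat"] exI[of _ "1::nat"])
next
  case (Suc m)
  let ?w = "\<lambda>a. l1_norm v (m + 1) (\<lambda>x. f (a # x))"
  have norm: "l1_norm v (Suc m + 1) f = sum ?w {1..v}"
    using l1_norm_Suc[of v "m + 1" f] by simp
  have "\<exists>j\<le>m + 2. sum ?w {1..v} + 2 ^ (j + 1) = 2 ^ (m + 3)"
  proof (rule slice_sum_spectrum)
    fix a assume a: "a \<in> {1..v}"
    show "?w a \<le> sum ?w ({1..v} - {a})"
      using l1_norm_slice_le[of v "m + 1" f a] Suc.prems(1) a by simp
    assume "?w a < 2 ^ (m + 2)"
    then show "\<exists>j\<le>m + 1. ?w a + 2 ^ (j + 1) = 2 ^ (m + 2)"
      using Suc.IH line_balanced_slice[of v m f a] Suc.prems(1) a by simp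
  qed (use Suc.prems(2) norm l1_norm_nonneg in \<open>auto simp: numeral_eq_Suc\<close>)
  then show ?case using norm by (simp add: numeral_eq_Suc)
qed

section \<open>From Latin trades to functions with vanishing line sums\<close>

lemma size_filter_mset_eq_sum:
  assumes "set_mset M \<subseteq> B" "finite B"
  shows "size (filter_mset P M) = (\<Sum>x\<in>{x\<in>B. P x}. count M x)"
proof -
  have "size (filter_mset P M) = (\<Sum>x\<in>set_mset (filter_mset P M). count (filter_mset P M) x)"
    by (simp add: size_multiset_overloaded_eq)
  also have "\<dots> = (\<Sum>x\<in>{x\<in>B. P x}. count (filter_mset P M) x)"
    using assms by (intro sum.mono_neutral_left) (auto simp: not_in_iff)
  also have "\<dots> = (\<Sum>x\<in>{x\<in>B. P x}. count M x)"
    by (rule sum.cong) auto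
  finally show ?thesis .
qed

lemma sorted_list_of_set_lessThan_remove:
  assumes "j \<le> t"
  shows "sorted_list_of_set ({..<Suc t} - {j}) = [0..<j] @ [Suc j..<Suc t]"
proof -
  have "set ([0..<j] @ [Suc j..<Suc t]) = {..<Suc t} - {j}" using assms by auto
  moreover have "sorted ([0..<j] @ [Suc j..<Suc t])" by (auto simp: sorted_append)
  moreover have "distinct ([0..<j] @ [Suc j..<Suc t])" by auto
  ultimately show ?thesis by (metis sorted_list_of_set.idem_if_sorted_distinct)
qed

text \<open>Reading \<open>x\<close> on all coordinates but \<open>length ys\<close> amounts to
  deleting that entry, so only the deleted entry remains free.\<close>

lemma tuple_contains_line:
  assumes x: "length x = Suc t" and len: "length ys + length zs = t"
  shows "tuple_contains x ({..<Suc t} - {length ys}) (ys @ zs) \<longleftrightarrow>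
    x = ys @ (x ! length ys) # zs"
proof -
  let ?j = "length ys" and ?L = "[0..<length ys] @ [Suc (length ys)..<Suc t]"
  have lj: "?j \<le> t" using len by simp
  have length_map: "length (map ((!) x) ?L) = length (ys @ zs)" using len by simp
  have "tuple_contains x ({..<Suc t} - {?j}) (ys @ zs) \<longleftrightarrow>
      (\<forall>i<length (ys @ zs). map ((!) x) ?L ! i = (ys @ zs) ! i)"
    unfolding tuple_contains_def sorted_list_of_set_lessThan_remove[OF lj]
    using len by (intro all_cong arg_cong2[of _ _ _ _ "(=)"] refl) (subst nth_map, auto)
  also have "\<dots> \<longleftrightarrow> map ((!) x) ?L = ys @ zs"
    using length_map by (metis nth_equalityI)
  also have "map ((!) x) ?L = take ?j x @ drop (Suc ?j) x"
  proof -
    have "map ((!) x) [0..<?j] = take ?j x"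
      using x lj by (intro nth_equalityI) auto
    moreover have "map ((!) x) [Suc ?j..<Suc t] = drop (Suc ?j) x"
      using x lj by (intro nth_equalityI) (auto simp del: upt_Suc)
    ultimately show ?thesis by simp
  qed
  also have "take ?j x @ drop (Suc ?j) x = ys @ zs \<longleftrightarrow> take ?j x = ys \<and> drop (Suc ?j) x = zs"
    using x lj by (intro append_eq_append_conv) auto
  also have "\<dots> \<longleftrightarrow> x = ys @ (x ! ?j) # zs"
  proof
    assume "take ?j x = ys \<and> drop (Suc ?j) x = zs"
    then show "x = ys @ (x ! ?j) # zs" using id_take_nth_drop[of ?j x] x lj by simp
  next
    assume eq: "x = ys @ (x ! ?j) # zs"
    show "take ?j x = ys \<and> drop (Suc ?j) x = zs"
      using arg_cong[OF eq, of "take ?j"] arg_cong[OF eq, of "drop (Suc ?j)"] by simp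
  qed
  finally show ?thesis .
qed

lemma line_eq_image:
  assumes "ys @ zs \<in> tuples v t"
  shows "{x \<in> tuples v (Suc t). tuple_contains x ({..<Suc t} - {length ys}) (ys @ zs)} =
    (\<lambda>a. ys @ a # zs) ` {1..v}" (is "?L = ?R")
proof
  from assms have len: "length ys + length zs = t" by (simp add: tuples_def)
  show "?L \<subseteq> ?R"
  proof
    fix x assume x: "x \<in> ?L"
    then have lx: "length x = Suc t" and sx: "set x \<subseteq> {1..v}" by (auto simp: tuples_def)
    from x have "x = ys @ (x ! length ys) # zs" using tuple_contains_line[OF lx len] by simp
    moreover have "x ! length ys \<in> {1..v}" using sx lx len nth_mem[of "length ys" x] by (simp add: subset_iff)
    ultimately show "x \<in> ?R" by blast
  qed
  show "?R \<subseteq> ?L"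
  proof
    fix x assume "x \<in> ?R"
    then obtain a where a: "a \<in> {1..v}" "x = ys @ a # zs" by blast
    then have "length x = Suc t" using len by simp
    from tuple_contains_line[OF this len] a assms show "x \<in> ?L" by (auto simp: tuples_def)
  qed
qed

text \<open>For \<open>k = t + 1\<close> a \<open>t\<close>-subset of coordinates omits exactly one,
  so the tuples counted by the trade condition form a line.\<close>

lemma latin_trade_line_balanced:
  assumes "latin_trade t v (t + 1) s (T1, T2)"
  shows "line_balanced v (t + 1) (\<lambda>x. int (count T1 x) - int (count T2 x))"
  unfolding line_balanced_def
proof (intro allI impI)
  fix ys zs assume "ys @ zs \<in> tuples v (t + 1 - 1)"
  then have u: "ys @ zs \<in> tuples v t" by simp
  let ?I = "{..<Suc t} - {length ys}"
  have "length ys \<le> t" using u by (simp add: tuples_def)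
  then have "?I \<subseteq> {..<t + 1}" "card ?I = t" by auto
  with u assms have eq: "size {# x \<in># T1. tuple_contains x ?I (ys @ zs) #} =
      size {# x \<in># T2. tuple_contains x ?I (ys @ zs) #}"
    unfolding latin_trade_def by blast
  have size: "size {# x \<in># M. tuple_contains x ?I (ys @ zs) #} =
      (\<Sum>a\<in>{1..v}. count M (ys @ a # zs))" if "set_mset M \<subseteq> tuples v (t + 1)" for M
    using size_filter_mset_eq_sum[OF that] line_eq_image[OF u]
    by (simp add: sum.reindex inj_on_def)
  have "(\<Sum>a\<in>{1..v}. count T1 (ys @ a # zs)) = (\<Sum>a\<in>{1..v}. count T2 (ys @ a # zs))"
    using eq assms size[of T1] size[of T2] by (simp add: latin_trade_def)
  then show "(\<Sum>a\<in>{1..v}. int (count T1 (ys @ a # zs)) - int (count T2 (ys @ a # zs))) = 0"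
    by (simp add: sum_subtractf flip: of_nat_sum)
qed

lemma latin_trade_l1_norm:
  assumes "latin_trade t v k s (T1, T2)"
  shows "l1_norm v k (\<lambda>x. int (count T1 x) - int (count T2 x)) = 2 * int s"
proof -
  have disj: "set_mset T1 \<inter> set_mset T2 = {}"
    and sub: "set_mset T1 \<subseteq> tuples v k" "set_mset T2 \<subseteq> tuples v k"
    and sz: "size T1 = s" "size T2 = s"
    using assms by (simp_all add: latin_trade_def)
  \<comment> \<open>Disjointness makes one of the two counts zero, so nothing cancels in the
    difference.\<close>
  have abs: "\<bar>int (count T1 x) - int (count T2 x)\<bar> = int (count T1 x) + int (count T2 x)" for x
    using disj by (cases "x \<in># T1") (auto simp: not_in_iff disjoint_iff)
  have "(\<Sum>x\<in>tuples v k. count T1 x) = s" "(\<Sum>x\<in>tuples v k. count T2 x) = s"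
    using size_filter_mset_eq_sum[OF sub(1), of "\<lambda>_. True"]
      size_filter_mset_eq_sum[OF sub(2), of "\<lambda>_. True"] sz by simp_all
  then show ?thesis
    by (simp add: l1_norm_def abs sum.distrib flip: of_nat_sum)
qed

theorem theorem3:
  fixes t i s v :: nat
  assumes "t \<ge> 1" and "1 \<le> i" and "i \<le> t"
    and "2 ^ (t + 1) - 2 ^ ((t + 1) - i) < s"
    and "s < 2 ^ (t + 1) - 2 ^ ((t + 1) - (i + 1))"
    and "v \<ge> 1"
  shows "\<not> (\<exists>T. latin_trade t v (t + 1) s T)"
proof
  assume "\<exists>T. latin_trade t v (t + 1) s T"
  then obtain T1 T2 where T: "latin_trade t v (t + 1) s (T1, T2)" by auto
  let ?f = "\<lambda>x. int (count T1 x) - int (count T2 x)"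
  have norm: "l1_norm v (t + 1) ?f = int (2 * s)" using latin_trade_l1_norm[OF T] by simp
  have "2 * s < 2 ^ (t + 2)" using assms(5) by simp
  then have "int (2 * s) < int (2 ^ (t + 2))" by (simp only: of_nat_less_iff)
  then have "l1_norm v (t + 1) ?f < 2 ^ (t + 2)" using norm by simp
  from line_balanced_norm_spectrum[OF latin_trade_line_balanced[OF T] this]
  obtain j where "int (2 * s) + 2 ^ (j + 1) = 2 ^ (t + 2)" unfolding norm by blast
  then have "int (2 * s + 2 ^ (j + 1)) = int (2 ^ (t + 2))" by simp
  then have "2 * s + 2 ^ (j + 1) = 2 ^ (t + 2)" by (simp only: of_nat_eq_iff)
  then have s: "s + 2 ^ j = 2 ^ (t + 1)" by simp
  \<comment> \<open>The bounds on \<open>s\<close> are values of \<open>2 ^ (t + 1) - 2 ^ j\<close>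
    at the consecutive exponents \<open>t + 1 - i\<close> and \<open>t - i\<close>, which leave no
    room for \<open>j\<close>.\<close>
  have "(2::nat) ^ j < 2 ^ (t + 1 - i)" using s assms(4) by linarith
  moreover have "(2::nat) ^ (t + 1 - (i + 1)) < 2 ^ j" using s assms(5) by linarith
  ultimately have "j < t + 1 - i" "t + 1 - (i + 1) < j"
    by (simp_all only: power_strict_increasing_iff one_less_numeral_iff semiring_norm)
  then show False by simp
qed

end
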